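(* Let the input be one-dimensional with $n$ equally spaced design points (spacing $d_0>0$), constant mean basis $h(x)=1$, and power exponential correlation with roughness $\alpha=1$, so that with $\rho=e^{-d_0/\gamma}$ the correlation matrix is $\mathbf R=(\rho^{|i-j|})_{1\le i,j\le n}$. Let $\mathbf y=(y_1,\dots,y_n)^T$ be the outputs at the successive design points and $\bar y=\sum_{i=1}^n y_i/n$. A necessary and sufficient condition that the mode of the profile likelihood $$L(\rho)\propto|\mathbf R|^{-1/2}(S^2)^{-n/2}$$ is at $\rho=0$ is $$\sum_{i=1}^{n-1}(y_i-\bar y)(y_{i+1}-\bar y)\le0 .$$
   Context: Here $S^2=\mathbf y^T\mathbf Q\mathbf y$ with $\mathbf Q=\mathbf R^{-1}-\mathbf R^{-1}\mathbf 1_n(\mathbf 1_n^T\mathbf R^{-1}\mathbf 1_n)^{-1}\mathbf 1_n^T\mathbf R^{-1}$, where $\mathbf 1_n$ is the vector of ones. The profile likelihood is the Gaussian likelihood of $\mathbf y\sim N(\theta\mathbf 1_n,\sigma^2\mathbf R)$ with $\theta$ and $\sigma^2$ replaced by their maximum likelihood estimates given $\rho$; it is viewed as a function of $\rho\in[0,1)$, where $\rho=0$ (the limit $\gamma\to0$) corresponds to $\mathbf R=\mathbf I_n$. The value at $\rho=0$ is the limit as $\rho\to0^+$. $\mathbf y$ is a (generic, in particular non-constant) realization of the Gaussian model. *)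

theory Defs
  imports Complex_Main
    "Jordan_Normal_Form.Determinant"
    "Jordan_Normal_Form.Gauss_Jordan_Elimination"
begin

text \<open>Vectors and matrices are those of \<open>Jordan_Normal_Form\<close>, hence indexed from 0: the
  entry \<open>y $ i\<close> is the output usually written with index \<open>i + 1\<close>.\<close>

text \<open>Only meaningful for invertible matrices; all correlation matrices below are positive
  definite.\<close>

abbreviation minv :: "real mat \<Rightarrow> real mat" where
  "minv A \<equiv> the (mat_inverse A)"

definition ones_vec :: "nat \<Rightarrow> real vec" where
  "ones_vec n = vec n (\<lambda>_. 1)"

text \<open>Power exponential correlation with range \<open>\<gamma>\<close> and roughness \<open>\<alpha>\<close>. The value at distance 0
  is 1, because \<open>0 powr \<alpha> = 0\<close>.\<close>

definition power_exp_corr :: "real \<Rightarrow> real \<Rightarrow> real \<Rightarrow> real" where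
  "power_exp_corr \<gamma> \<alpha> d = exp (- ((d / \<gamma>) powr \<alpha>))"

definition corr_matrix :: "real \<Rightarrow> real \<Rightarrow> real vec \<Rightarrow> real mat" where
  "corr_matrix \<gamma> \<alpha> x =
     mat (dim_vec x) (dim_vec x) (\<lambda>(i, j). power_exp_corr \<gamma> \<alpha> \<bar>x $ i - x $ j\<bar>)"

text \<open>At \<open>\<rho> = 0\<close> this is the identity matrix, because \<open>0 ^ 0 = 1\<close>.\<close>

definition geom_corr_matrix :: "nat \<Rightarrow> real \<Rightarrow> real mat" where
  "geom_corr_matrix n \<rho> = mat n n (\<lambda>(i, j). \<rho> ^ nat \<bar>int i - int j\<bar>)"

definition multi_normal_density :: "real vec \<Rightarrow> real mat \<Rightarrow> real vec \<Rightarrow> real" where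
  "multi_normal_density \<mu> \<Sigma> y =
     (2 * pi) powr (- real (dim_vec y) / 2) * det \<Sigma> powr (- 1 / 2)
       * exp (- ((y - \<mu>) \<bullet> (minv \<Sigma> *\<^sub>v (y - \<mu>))) / 2)"

definition likelihood :: "real mat \<Rightarrow> real vec \<Rightarrow> real \<Rightarrow> real \<Rightarrow> real" where
  "likelihood R y \<theta> \<sigma>2 =
     multi_normal_density (\<theta> \<cdot>\<^sub>v ones_vec (dim_vec y)) (\<sigma>2 \<cdot>\<^sub>m R) y"

text \<open>The pair of maximum likelihood estimates of the mean \<open>\<theta>\<close> and the variance \<open>\<sigma>2\<close> given \<open>R\<close>.
  They exist and are unique for positive definite \<open>R\<close> and non-constant \<open>y\<close>.\<close>

definition mle :: "real mat \<Rightarrow> real vec \<Rightarrow> real \<times> real" where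
  "mle R y = arg_max (\<lambda>(\<theta>, \<sigma>2). likelihood R y \<theta> \<sigma>2) (\<lambda>(\<theta>, \<sigma>2). \<sigma>2 > 0)"

definition profile_likelihood :: "real mat \<Rightarrow> real vec \<Rightarrow> real" where
  "profile_likelihood R y = (case mle R y of (\<theta>, \<sigma>2) \<Rightarrow> likelihood R y \<theta> \<sigma>2)"

text \<open>\<open>Q = R\<^sup>-\<^sup>1 - R\<^sup>-\<^sup>1 1 (1\<^sup>T R\<^sup>-\<^sup>1 1)\<^sup>-\<^sup>1 1\<^sup>T R\<^sup>-\<^sup>1\<close>; the factor in the middle is a scalar and
  is pulled to the front, and \<open>U\<close> is the vector of ones as a column matrix.\<close>

definition Q_mat :: "real mat \<Rightarrow> real mat" where
  "Q_mat R =
     (let u = ones_vec (dim_row R); U = mat_of_cols (dim_row R) [u]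
      in minv R - inverse (u \<bullet> (minv R *\<^sub>v u)) \<cdot>\<^sub>m (minv R * U * U\<^sup>T * minv R))"

definition S2 :: "real mat \<Rightarrow> real vec \<Rightarrow> real" where
  "S2 R y = y \<bullet> (Q_mat R *\<^sub>v y)"

definition modes :: "(real \<Rightarrow> real) \<Rightarrow> real set" where
  "modes L = {\<rho>. is_arg_max L (\<lambda>\<rho>. 0 \<le> \<rho> \<and> \<rho> < 1) \<rho>}"

definition mean_vec :: "real vec \<Rightarrow> real" where
  "mean_vec y = (\<Sum>i<dim_vec y. y $ i) / real (dim_vec y)"

end

theory Submission
  imports Defs
begin

text \<open>For \<open>0 \<le> \<rho> < 1\<close> the matrix \<open>R = (\<rho>\<^bsup>|i - j|\<^esup>)\<close> is the correlation matrix of a stationary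
  autoregressive process of order one. Replacing each value by its innovation
  \<open>v\<^sub>i - \<rho> v\<^sub>i\<^sub>-\<^sub>1\<close> makes the coordinates independent, with variance 1 at the start and
  \<open>1 - \<rho>\<^sup>2\<close> afterwards. This gives \<open>det R = (1 - \<rho>\<^sup>2)\<^sup>n\<^sup>-\<^sup>1\<close> (\<open>det_geom_corr\<close>) and turns the quadratic
  form of \<open>R\<^sup>-\<^sup>1\<close> into a sum of squared innovations (\<open>precision_form\<close>).

  Profiling is a matter of completing a square: the residual form
  \<open>q \<theta> = (y - \<theta> 1)\<^sup>T R\<^sup>-\<^sup>1 (y - \<theta> 1)\<close> has minimum \<open>S\<^sup>2\<close> over \<open>\<theta>\<close>, and the likelihood is then maximal at
  \<open>\<sigma>\<^sup>2 = S\<^sup>2 / n\<close>. Hence \<open>L\<close> is a constant times \<open>(det R)\<^bsup>-1/2\<^esup> (S\<^sup>2)\<^bsup>-n/2\<^esup>\<close> (\<open>profile_likelihood_eq\<close>). For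
  \<open>\<rho> > 0\<close> this is immediate, and at \<open>\<rho> = 0\<close> it follows from the continuity of \<open>S\<^sup>2\<close>.

  Let \<open>z\<close> be the centred data, \<open>\<delta> = \<theta> - mean_vec y\<close>, \<open>a = \<Sum>z\<^sub>i\<^sup>2\<close> and \<open>s = \<Sum>z\<^sub>i z\<^sub>i\<^sub>+\<^sub>1\<close>. The heart of
  the argument is the identity (\<open>ar_form_decomp\<close>), in which the last sum runs over the interior points:
  \<open>(1 - \<rho>\<^sup>2) q \<theta> = a - 2 \<rho> s + 2 (1 - \<rho>) \<delta>\<^sup>2 + \<Sum>(\<rho> z\<^sub>i + (1 - \<rho>) \<delta>)\<^sup>2\<close>.
  Its last two terms are nonnegative for every \<open>\<theta>\<close>, so \<open>(1 - \<rho>\<^sup>2) S\<^sup>2 \<ge> a - 2 \<rho> s\<close>; at \<open>\<delta> = 0\<close> they are of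
  order \<open>\<rho>\<^sup>2\<close>, so \<open>(1 - \<rho>\<^sup>2) S\<^sup>2 \<le> a - 2 \<rho> s + O(\<rho>\<^sup>2)\<close>.

  Up to a constant, \<open>L\<^sup>-\<^sup>2\<close> is \<open>((1 - \<rho>\<^sup>2) S\<^sup>2)\<^sup>n / (1 - \<rho>\<^sup>2)\<close>, with value \<open>a\<^sup>n\<close> at \<open>\<rho> = 0\<close>. If \<open>s \<le> 0\<close>, the
  numerator is at least \<open>a\<^sup>n\<close>, and the denominator is below 1 for \<open>\<rho> > 0\<close>, so \<open>0\<close> is the only mode. If
  \<open>s > 0\<close>, the numerator decreases at first order in \<open>\<rho>\<close> and the denominator only at second
  order, so \<open>L\<close> exceeds its value at \<open>0\<close> for small \<open>\<rho>\<close>.\<close>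

section \<open>Profiling out the mean and the variance\<close>

lemma minv_eqI:
  assumes "A \<in> carrier_mat n n" "B \<in> carrier_mat n n" "A * B = 1\<^sub>m n"
  shows "minv A = B"
proof (cases "mat_inverse A")
  case None
  have "B * A = 1\<^sub>m n"
    using mat_mult_left_right_inverse[OF assms] .
  then have "A \<in> Units (ring_mat TYPE(real) n ())"
    using assms by (auto simp: Units_def ring_mat_def)
  then show ?thesis
    using mat_inverse(1)[OF assms(1) None, of "()"] by simp
next
  case (Some C)
  have C: "C * A = 1\<^sub>m n" "C \<in> carrier_mat n n"
    using mat_inverse(2)[OF assms(1) Some] by auto
  have "C = C * (A * B)"
    using assms C by simp
  also have "\<dots> = (C * A) * B"
    by (rule assoc_mult_mat[symmetric, OF C(2) assms(1,2)])
  also have "\<dots> = B"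
    using assms C by simp
  finally show ?thesis
    using Some by simp
qed

lemma smult_mat_mult_vec:
  assumes "A \<in> carrier_mat nr nc" "v \<in> carrier_vec nc"
  shows "(k \<cdot>\<^sub>m A) *\<^sub>v v = k \<cdot>\<^sub>v (A *\<^sub>v v)"
  using assms by (intro eq_vecI) (auto simp: scalar_prod_def sum_distrib_left mult.assoc)

lemma ones_vec_carrier [simp]: "ones_vec n \<in> carrier_vec n"
  by (simp add: ones_vec_def)

lemma dim_ones_vec [simp]: "dim_vec (ones_vec n) = n"
  by (simp add: ones_vec_def)

text \<open>The inverse gamma kernel \<open>s \<mapsto> s\<^sup>-\<^sup>m exp (- S / s)\<close> peaks at \<open>s = S / m\<close>. With \<open>t = S / (m s)\<close> the claim is
  \<open>ln t \<le> t - 1\<close>, multiplied by \<open>m\<close>.\<close>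

lemma powr_mult_exp_le:
  fixes s S m :: real
  assumes "s > 0" "S > 0" "m > 0"
  shows "s powr (- m) * exp (- S / s) \<le> (S / m) powr (- m) * exp (- m)"
proof -
  define t where "t = S / m / s"
  have "m * ln t \<le> m * (t - 1)"
    using assms by (intro mult_left_mono ln_le_minus_one) (auto simp: t_def)
  moreover have "m * t = S / s"
    using assms by (simp add: t_def)
  moreover have "ln t = ln (S / m) - ln s"
    using assms by (simp add: t_def ln_div ln_mult)
  ultimately have "- m * ln s - S / s \<le> - m * ln (S / m) - m"
    by (simp add: algebra_simps)
  then have "exp (- m * ln s - S / s) \<le> exp (- m * ln (S / m) - m)"
    by simp
  then show ?thesis
    using assms by (simp add: powr_def exp_diff exp_minus divide_inverse)
qed

text \<open>The profile likelihood is computed for any positive definite correlation matrix; the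
  inverse \<open>K\<close> is a parameter so that an explicit precision matrix can be supplied.\<close>

locale pos_def_with_inverse =
  fixes n :: nat and R K :: "real mat"
  assumes R_carrier: "R \<in> carrier_mat n n" and K_carrier: "K \<in> carrier_mat n n"
    and inverse: "R * K = 1\<^sub>m n"
    and symmetric: "u \<in> carrier_vec n \<Longrightarrow> v \<in> carrier_vec n \<Longrightarrow> u \<bullet> (K *\<^sub>v v) = v \<bullet> (K *\<^sub>v u)"
    and positive: "v \<in> carrier_vec n \<Longrightarrow> v \<noteq> 0\<^sub>v n \<Longrightarrow> v \<bullet> (K *\<^sub>v v) > 0"
    and det_pos: "det R > 0"
begin

lemma minv_smult:
  assumes "s > 0"
  shows "minv (s \<cdot>\<^sub>m R) = (1 / s) \<cdot>\<^sub>m K"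
proof (rule minv_eqI[of _ n])
  have "(s \<cdot>\<^sub>m R) * ((1 / s) \<cdot>\<^sub>m K) = (1 / s) \<cdot>\<^sub>m (s \<cdot>\<^sub>m (R * K))"
    using R_carrier K_carrier
    by (simp add: mult_smult_assoc_mat[of R n n] mult_smult_distrib[of "s \<cdot>\<^sub>m R" n n])
  then show "(s \<cdot>\<^sub>m R) * ((1 / s) \<cdot>\<^sub>m K) = 1\<^sub>m n"
    using assms inverse by (intro eq_matI) auto
qed (use R_carrier K_carrier in auto)

lemma minv_R: "minv R = K"
  by (rule minv_eqI[OF R_carrier K_carrier inverse])

lemma ones_form_pos:
  assumes "n > 0"
  shows "ones_vec n \<bullet> (K *\<^sub>v ones_vec n) > 0"
proof (rule positive)
  have "ones_vec n $ 0 \<noteq> 0\<^sub>v n $ 0"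
    using assms by (simp add: ones_vec_def)
  then show "ones_vec n \<noteq> 0\<^sub>v n"
    by metis
qed simp

lemma S2_eq:
  assumes y: "y \<in> carrier_vec n"
  shows "S2 R y = y \<bullet> (K *\<^sub>v y)
    - (ones_vec n \<bullet> (K *\<^sub>v y))\<^sup>2 / (ones_vec n \<bullet> (K *\<^sub>v ones_vec n))"
proof -
  define u U where "u = ones_vec n" and "U = mat_of_cols n [u]"
  have u: "u \<in> carrier_vec n" and U: "U \<in> carrier_mat n 1" and UT: "U\<^sup>T \<in> carrier_mat 1 n"
    by (auto simp: u_def U_def)
  define w where "w = K *\<^sub>v y"
  have w: "w \<in> carrier_vec n"
    using K_carrier y by (simp add: w_def)
  have Uw: "U *\<^sub>v (U\<^sup>T *\<^sub>v w) = (u \<bullet> w) \<cdot>\<^sub>v u"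
    using u U w
    by (intro eq_vecI) (auto simp: U_def scalar_prod_def mat_of_cols_def)
  have K: "K \<in> carrier_mat n n" by (rule K_carrier)
  have KU: "K * U \<in> carrier_mat n 1" and KUU: "K * U * U\<^sup>T \<in> carrier_mat n n"
    using K U UT by auto
  have "(K * U * U\<^sup>T * K) *\<^sub>v y = K *\<^sub>v (U *\<^sub>v (U\<^sup>T *\<^sub>v w))"
    unfolding w_def
    using assoc_mult_mat_vec[OF KUU K y] assoc_mult_mat_vec[OF KU UT w]
      assoc_mult_mat_vec[OF K U mult_mat_vec_carrier[OF UT w]]
    by (simp add: w_def)
  also have "\<dots> = (u \<bullet> w) \<cdot>\<^sub>v (K *\<^sub>v u)"
    unfolding Uw using K u by (rule mult_mat_vec)
  finally have *: "(K * U * U\<^sup>T * K) *\<^sub>v y = (u \<bullet> w) \<cdot>\<^sub>v (K *\<^sub>v u)" .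
  have dimR: "dim_row R = n" using R_carrier by auto
  have KUUK: "K * U * U\<^sup>T * K \<in> carrier_mat n n"
    using KUU K by (rule mult_carrier_mat)
  define k where "k = inverse (u \<bullet> (K *\<^sub>v u))"
  have "S2 R y = y \<bullet> ((K - k \<cdot>\<^sub>m (K * U * U\<^sup>T * K)) *\<^sub>v y)"
    by (simp add: S2_def Q_mat_def minv_R dimR Let_def u_def U_def k_def)
  also have "(K - k \<cdot>\<^sub>m (K * U * U\<^sup>T * K)) *\<^sub>v y
      = K *\<^sub>v y - k \<cdot>\<^sub>v ((K * U * U\<^sup>T * K) *\<^sub>v y)"
    using K KUUK y
    by (simp add: minus_mult_distrib_mat_vec[of _ n n] smult_mat_mult_vec[of _ n n])
  also have "y \<bullet> (K *\<^sub>v y - k \<cdot>\<^sub>v ((K * U * U\<^sup>T * K) *\<^sub>v y))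
      = y \<bullet> (K *\<^sub>v y) - k * ((u \<bullet> w) * (y \<bullet> (K *\<^sub>v u)))"
    unfolding * using K y u by (simp add: scalar_prod_minus_distrib[of _ n])
  also have "y \<bullet> (K *\<^sub>v u) = u \<bullet> w"
    unfolding w_def using symmetric y u by blast
  finally show ?thesis
    by (simp add: k_def u_def w_def power2_eq_square field_simps)
qed

text \<open>Completing the square in \<open>\<theta>\<close>: the minimizer \<open>g / w\<close> is the generalized least squares estimate of
  the mean, and the minimum is \<open>S\<^sup>2\<close>.\<close>

lemma residual_form_eq:
  assumes y: "y \<in> carrier_vec n" and n: "n > 0"
  defines "g \<equiv> ones_vec n \<bullet> (K *\<^sub>v y)" and "w \<equiv> ones_vec n \<bullet> (K *\<^sub>v ones_vec n)"
  shows "(y - \<theta> \<cdot>\<^sub>v ones_vec n) \<bullet> (K *\<^sub>v (y - \<theta> \<cdot>\<^sub>v ones_vec n))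
    = S2 R y + w * (\<theta> - g / w)\<^sup>2"
proof -
  define u where "u = ones_vec n"
  have u: "u \<in> carrier_vec n" by (simp add: u_def)
  have K: "K \<in> carrier_mat n n" by (rule K_carrier)
  have "(y - \<theta> \<cdot>\<^sub>v u) \<bullet> (K *\<^sub>v (y - \<theta> \<cdot>\<^sub>v u))
      = y \<bullet> (K *\<^sub>v y) - \<theta> * (y \<bullet> (K *\<^sub>v u)) - \<theta> * (u \<bullet> (K *\<^sub>v y)) + \<theta>\<^sup>2 * (u \<bullet> (K *\<^sub>v u))"
    using K u y
    by (simp add: mult_minus_distrib_mat_vec[of _ n n] mult_mat_vec[of _ n n]
        scalar_prod_minus_distrib[of _ n] minus_scalar_prod_distrib[of _ n] algebra_simps power2_eq_square)
  also have "y \<bullet> (K *\<^sub>v u) = u \<bullet> (K *\<^sub>v y)"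
    by (rule symmetric[OF y u])
  finally have "(y - \<theta> \<cdot>\<^sub>v u) \<bullet> (K *\<^sub>v (y - \<theta> \<cdot>\<^sub>v u)) = y \<bullet> (K *\<^sub>v y) - 2 * \<theta> * g + \<theta>\<^sup>2 * w"
    by (simp add: g_def w_def u_def)
  moreover have "w > 0"
    unfolding w_def by (rule ones_form_pos[OF n])
  then have "w * (\<theta> - g / w)\<^sup>2 = \<theta>\<^sup>2 * w - 2 * \<theta> * g + g\<^sup>2 / w"
    by (simp add: power2_eq_square field_simps)
  ultimately show ?thesis
    unfolding S2_eq[OF y] u_def g_def[symmetric] w_def[symmetric]
    by simp
qed

lemma S2_le_residual_form:
  assumes y: "y \<in> carrier_vec n" and n: "n > 0"
  shows "S2 R y \<le> (y - \<theta> \<cdot>\<^sub>v ones_vec n) \<bullet> (K *\<^sub>v (y - \<theta> \<cdot>\<^sub>v ones_vec n))"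
  unfolding residual_form_eq[OF assms] using ones_form_pos[OF n] by simp

lemma S2_attained:
  assumes y: "y \<in> carrier_vec n" and n: "n > 0"
  obtains \<theta> where "(y - \<theta> \<cdot>\<^sub>v ones_vec n) \<bullet> (K *\<^sub>v (y - \<theta> \<cdot>\<^sub>v ones_vec n)) = S2 R y"
proof
  show "(y - (ones_vec n \<bullet> (K *\<^sub>v y) / (ones_vec n \<bullet> (K *\<^sub>v ones_vec n))) \<cdot>\<^sub>v ones_vec n)
      \<bullet> (K *\<^sub>v (y - (ones_vec n \<bullet> (K *\<^sub>v y) / (ones_vec n \<bullet> (K *\<^sub>v ones_vec n))) \<cdot>\<^sub>v ones_vec n)) = S2 R y"
    unfolding residual_form_eq[OF assms] by simp
qed

text \<open>The minimum \<open>S\<^sup>2\<close> is attained at some residual, which is nonzero for non-constant data.\<close>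

lemma S2_pos:
  assumes y: "y \<in> carrier_vec n" and nonconst: "i < n" "j < n" "y $ i \<noteq> y $ j"
  shows "S2 R y > 0"
proof -
  obtain \<theta> where \<theta>: "(y - \<theta> \<cdot>\<^sub>v ones_vec n) \<bullet> (K *\<^sub>v (y - \<theta> \<cdot>\<^sub>v ones_vec n)) = S2 R y"
    using S2_attained[OF y] nonconst by auto
  have "y - \<theta> \<cdot>\<^sub>v ones_vec n \<noteq> 0\<^sub>v n"
  proof
    assume 0: "y - \<theta> \<cdot>\<^sub>v ones_vec n = 0\<^sub>v n"
    have "y $ k = \<theta>" if "k < n" for k
      using arg_cong[OF 0, of "\<lambda>v. v $ k"] that y by (simp add: ones_vec_def)
    then show False
      using nonconst by simp
  qed
  then show ?thesis
    using positive[of "y - \<theta> \<cdot>\<^sub>v ones_vec n"] y \<theta> by simp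
qed

lemma likelihood_eq:
  assumes y: "y \<in> carrier_vec n" and s: "s > 0"
  shows "likelihood R y \<theta> s = (2 * pi) powr (- real n / 2) * det R powr (- 1 / 2)
    * (s powr (- real n / 2)
       * exp (- ((y - \<theta> \<cdot>\<^sub>v ones_vec n) \<bullet> (K *\<^sub>v (y - \<theta> \<cdot>\<^sub>v ones_vec n)) / 2) / s))"
proof -
  have "det (s \<cdot>\<^sub>m R) powr (- 1 / 2) = (s powr real n) powr (- 1 / 2) * det R powr (- 1 / 2)"
    using R_carrier s det_pos by (simp add: powr_mult powr_realpow)
  then have "det (s \<cdot>\<^sub>m R) powr (- 1 / 2) = s powr (- real n / 2) * det R powr (- 1 / 2)"
    by (simp add: powr_powr)
  moreover have "((1 / s) \<cdot>\<^sub>m K) *\<^sub>v v = (1 / s) \<cdot>\<^sub>v (K *\<^sub>v v)" if "v \<in> carrier_vec n" for v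
    using K_carrier that by (simp add: smult_mat_mult_vec[of _ n n])
  ultimately show ?thesis
    using y K_carrier s unfolding likelihood_def multi_normal_density_def minv_smult[OF s]
    by (simp add: field_simps)
qed

text \<open>The definition of \<open>mle\<close> selects some maximizer. Its likelihood is determined without
  uniqueness: an upper bound \<open>M\<close> for the likelihood is attained, at the generalized least squares
  mean and \<open>\<sigma>\<^sup>2 = S\<^sup>2 / n\<close>, so every maximizer has likelihood \<open>M\<close>.\<close>

lemma profile_likelihood_eq:
  assumes y: "y \<in> carrier_vec n" and nonconst: "i < n" "j < n" "y $ i \<noteq> y $ j"
  shows "profile_likelihood R y = (2 * pi) powr (- real n / 2) * (real n powr (real n / 2) * exp (- real n / 2))
    * det R powr (- 1 / 2) * S2 R y powr (- real n / 2)"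
proof -
  have n: "n > 0" using nonconst by simp
  define S where "S = S2 R y"
  have S: "S > 0"
    unfolding S_def using S2_pos[OF assms] .
  define q where "q \<theta> = (y - \<theta> \<cdot>\<^sub>v ones_vec n) \<bullet> (K *\<^sub>v (y - \<theta> \<cdot>\<^sub>v ones_vec n))" for \<theta>
  define C where "C = (2 * pi) powr (- real n / 2) * det R powr (- 1 / 2)"
  have C: "C > 0"
    using det_pos by (simp add: C_def)
  define M where "M = C * ((S / n) powr (- real n / 2) * exp (- real n / 2))"
  have lik: "likelihood R y \<theta> s = C * (s powr (- real n / 2) * exp (- (q \<theta> / 2) / s))" if "s > 0" for \<theta> s
    unfolding likelihood_eq[OF y that] C_def q_def ..
  have upper: "likelihood R y \<theta> s \<le> M" if s: "s > 0" for \<theta> s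
  proof -
    have "exp (- (q \<theta> / 2) / s) \<le> exp (- (S / 2) / s)"
      using S2_le_residual_form[OF y n, of \<theta>] s by (simp add: S_def q_def divide_right_mono)
    then have "s powr (- real n / 2) * exp (- (q \<theta> / 2) / s) \<le> s powr (- (real n / 2)) * exp (- (S / 2) / s)"
      by (simp add: mult_left_mono)
    also have "\<dots> \<le> ((S / 2) / (real n / 2)) powr (- (real n / 2)) * exp (- (real n / 2))"
      by (rule powr_mult_exp_le) (use s S n in auto)
    finally show ?thesis
      unfolding lik[OF s] M_def using C by simp
  qed
  obtain \<theta>0 where "q \<theta>0 = S"
    unfolding q_def S_def using S2_attained[OF y n] .
  then have attained: "likelihood R y \<theta>0 (S / n) = M"
    using S n by (subst lik) (simp_all add: M_def)
  have "is_arg_max (\<lambda>(\<theta>, s). likelihood R y \<theta> s) (\<lambda>(\<theta>, s). s > 0) (\<theta>0, S / n)"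
    using S n by (auto simp: is_arg_max_def attained) (metis upper leD)
  then have mle: "is_arg_max (\<lambda>(\<theta>, s). likelihood R y \<theta> s) (\<lambda>(\<theta>, s). s > 0) (mle R y)"
    unfolding mle_def arg_max_def by (rule someI)
  obtain \<theta> s where ts: "mle R y = (\<theta>, s)" by fastforce
  have "s > 0" "\<not> likelihood R y \<theta>0 (S / n) > likelihood R y \<theta> s"
    using mle S n unfolding ts by (auto simp: is_arg_max_def)
  then have "likelihood R y \<theta> s = M"
    using upper[of s \<theta>] attained by simp
  then have "profile_likelihood R y = M"
    by (simp add: profile_likelihood_def ts)
  also have "(S / n) powr (- real n / 2) = S powr (- real n / 2) * real n powr (real n / 2)"
    using S n by (simp add: powr_divide powr_minus field_simps)
  ultimately show ?thesis
    by (simp add: M_def C_def S_def field_simps)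
qed

end

section \<open>Geometric correlation as an autoregressive process\<close>

definition innovation :: "real \<Rightarrow> (nat \<Rightarrow> real) \<Rightarrow> nat \<Rightarrow> real" where
  "innovation \<rho> f i = (if i = 0 then f 0 else f i - \<rho> * f (i - 1))"

definition innovation_var :: "real \<Rightarrow> nat \<Rightarrow> real" where
  "innovation_var \<rho> i = (if i = 0 then 1 else 1 - \<rho>\<^sup>2)"

definition ar_form :: "nat \<Rightarrow> real \<Rightarrow> (nat \<Rightarrow> real) \<Rightarrow> (nat \<Rightarrow> real) \<Rightarrow> real" where
  "ar_form n \<rho> f g = (\<Sum>i<n. innovation \<rho> f i * innovation \<rho> g i / innovation_var \<rho> i)"

text \<open>With \<open>W\<close> the matrix taking a path to its innovations, \<open>U\<close> the transpose of \<open>W\<^sup>-\<^sup>1\<close> and \<open>D\<close> the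
  diagonal matrix of innovation variances, \<open>R = U\<^sup>T D U\<close> and \<open>R\<^sup>-\<^sup>1 = W\<^sup>T D\<^sup>-\<^sup>1 W\<close>. These are
  \<open>whitening_mat\<close> for \<open>W\<close>, \<open>response_mat\<close> for \<open>U\<close> and \<open>precision_mat\<close> for \<open>R\<^sup>-\<^sup>1\<close>.\<close>

definition whitening_mat :: "nat \<Rightarrow> real \<Rightarrow> real mat" where
  "whitening_mat n \<rho> = mat n n (\<lambda>(i, j). if j = i then 1 else if Suc j = i then - \<rho> else 0)"

definition response_mat :: "nat \<Rightarrow> real \<Rightarrow> real mat" where
  "response_mat n \<rho> = mat n n (\<lambda>(i, j). if i \<le> j then \<rho> ^ (j - i) else 0)"

definition precision_mat :: "nat \<Rightarrow> real \<Rightarrow> real mat" where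
  "precision_mat n \<rho> = (whitening_mat n \<rho>)\<^sup>T *
     (mat n n (\<lambda>(i, j). if i = j then 1 / innovation_var \<rho> i else 0) * whitening_mat n \<rho>)"

lemma innovation_var_pos: "0 \<le> \<rho> \<Longrightarrow> \<rho> < 1 \<Longrightarrow> innovation_var \<rho> i > 0"
  by (simp add: innovation_var_def power_less_one_iff)

lemma whitening_carrier [simp]: "whitening_mat n \<rho> \<in> carrier_mat n n"
  and response_carrier [simp]: "response_mat n \<rho> \<in> carrier_mat n n"
  and precision_carrier [simp]: "precision_mat n \<rho> \<in> carrier_mat n n"
  and geom_corr_carrier [simp]: "geom_corr_matrix n \<rho> \<in> carrier_mat n n"
  by (auto simp: whitening_mat_def response_mat_def precision_mat_def geom_corr_matrix_def)

lemma dim_row_whitening [simp]: "dim_row (whitening_mat n \<rho>) = n"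
  by (simp add: whitening_mat_def)

lemma row_whitening_scalar_prod:
  assumes v: "v \<in> carrier_vec n" and i: "i < n"
  shows "row (whitening_mat n \<rho>) i \<bullet> v = innovation \<rho> (\<lambda>i. v $ i) i"
proof -
  have "row (whitening_mat n \<rho>) i \<bullet> v
      = (\<Sum>j\<in>{0..<n}. (if j = i then 1 else if Suc j = i then - \<rho> else 0) * v $ j)"
    using assms by (auto simp: scalar_prod_def whitening_mat_def intro!: sum.cong)
  also have "\<dots> = (\<Sum>j\<in>{0..<n}. (if j = i then v $ j else 0)
      + (if i \<noteq> 0 \<and> j = i - 1 then - \<rho> * v $ j else 0))"
    by (intro sum.cong) auto
  also have "\<dots> = innovation \<rho> (\<lambda>i. v $ i) i"
    using i by (cases i) (auto simp: sum.distrib innovation_def)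
  finally show ?thesis .
qed

lemma whitening_mult_vec:
  "v \<in> carrier_vec n \<Longrightarrow> whitening_mat n \<rho> *\<^sub>v v = vec n (innovation \<rho> (\<lambda>i. v $ i))"
  by (intro eq_vecI) (auto simp: row_whitening_scalar_prod)

lemma whitening_mult_mat:
  "A \<in> carrier_mat n n \<Longrightarrow>
    whitening_mat n \<rho> * A = mat n n (\<lambda>(i, j). innovation \<rho> (\<lambda>i. col A j $ i) i)"
  by (intro eq_matI) (auto simp: row_whitening_scalar_prod)

lemma diag_mult_mat:
  assumes "A \<in> carrier_mat n n"
  shows "mat n n (\<lambda>(i, j). if i = j then d i else 0) * A = mat n n (\<lambda>(i, j). d i * A $$ (i, j) :: real)"
  using assms
  by (intro eq_matI) (auto simp: scalar_prod_def sum.delta' if_distrib[of "\<lambda>x. x * _"] cong: if_cong)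

lemma whitening_response: "whitening_mat n \<rho> * (response_mat n \<rho>)\<^sup>T = 1\<^sub>m n"
proof -
  have "innovation \<rho> (\<lambda>i. col (response_mat n \<rho>)\<^sup>T j $ i) i = (if i = j then 1 else 0)"
    if "i < n" "j < n" for i j
  proof (cases i)
    case 0
    then show ?thesis
      using that by (simp add: innovation_def response_mat_def)
  next
    case (Suc k)
    then consider "j \<le> k" | "j = Suc k" | "Suc k < j"
      by linarith
    then show ?thesis
      using that Suc by cases (simp_all add: innovation_def response_mat_def Suc_diff_le)
  qed
  then show ?thesis
    by (subst whitening_mult_mat, simp) (auto intro!: eq_matI)
qed

text \<open>The factorization \<open>R = U\<^sup>T D U\<close>, multiplied by \<open>W\<close> from the left: row \<open>i > 0\<close> of \<open>W R\<close> is
  \<open>\<rho>\<^bsup>|i - j|\<^esup> - \<rho> \<rho>\<^bsup>|i - 1 - j|\<^esup>\<close>, which cancels below the diagonal, and this one product yields both the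
  inverse and the determinant.\<close>

lemma whitening_geom_corr:
  "whitening_mat n \<rho> * geom_corr_matrix n \<rho>
    = mat n n (\<lambda>(i, j). if i = j then innovation_var \<rho> i else 0) * response_mat n \<rho>"
proof -
  have "innovation \<rho> (\<lambda>i. col (geom_corr_matrix n \<rho>) j $ i) i
      = innovation_var \<rho> i * response_mat n \<rho> $$ (i, j)" if "i < n" "j < n" for i j
  proof (cases i)
    case 0
    then show ?thesis
      using that by (simp add: innovation_def innovation_var_def geom_corr_matrix_def response_mat_def)
  next
    case (Suc k)
    show ?thesis
    proof (cases "i \<le> j")
      case True
      then have "nat \<bar>int i - int j\<bar> = j - i" "nat \<bar>int k - int j\<bar> = Suc (j - i)"
        using Suc by auto
      then show ?thesis
        using that True Suc
        by (simp add: innovation_def innovation_var_def geom_corr_matrix_def response_mat_def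
            algebra_simps power2_eq_square)
    next
      case False
      then have "nat \<bar>int i - int j\<bar> = Suc (k - j)" "nat \<bar>int k - int j\<bar> = k - j"
        using Suc by auto
      then show ?thesis
        using that False Suc
        by (simp add: innovation_def innovation_var_def geom_corr_matrix_def response_mat_def)
    qed
  qed
  then show ?thesis
    by (subst whitening_mult_mat, simp, subst diag_mult_mat, simp) (auto intro!: eq_matI)
qed

lemma precision_form:
  assumes u: "u \<in> carrier_vec n" and v: "v \<in> carrier_vec n"
  shows "u \<bullet> (precision_mat n \<rho> *\<^sub>v v) = ar_form n \<rho> (\<lambda>i. u $ i) (\<lambda>i. v $ i)"
proof -
  define W D where "W = whitening_mat n \<rho>"
    and "D = mat n n (\<lambda>(i, j). if i = j then 1 / innovation_var \<rho> i else 0)"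
  have W: "W \<in> carrier_mat n n" and D: "D \<in> carrier_mat n n"
    by (simp_all add: W_def D_def)
  define w where "w = W *\<^sub>v v"
  have w: "w \<in> carrier_vec n"
    using W v by (simp add: w_def)
  have "precision_mat n \<rho> *\<^sub>v v = W\<^sup>T *\<^sub>v ((D * W) *\<^sub>v v)"
    unfolding precision_mat_def W_def[symmetric] D_def[symmetric]
    by (rule assoc_mult_mat_vec[of _ n n _ n]) (use W D v in auto)
  also have "(D * W) *\<^sub>v v = D *\<^sub>v w"
    unfolding w_def by (rule assoc_mult_mat_vec[OF D W v])
  finally have "u \<bullet> (precision_mat n \<rho> *\<^sub>v v) = u \<bullet> (W\<^sup>T *\<^sub>v (D *\<^sub>v w))"
    by simp
  also have "\<dots> = (W *\<^sub>v u) \<bullet> (D *\<^sub>v w)"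
    using transpose_vec_mult_scalar[of "W\<^sup>T" n n "D *\<^sub>v w" u] W D w u by simp
  also have "\<dots> = ar_form n \<rho> (\<lambda>i. u $ i) (\<lambda>i. v $ i)"
    using w unfolding w_def W_def D_def whitening_mult_vec[OF u] whitening_mult_vec[OF v]
    by (auto simp: scalar_prod_def ar_form_def if_distrib[of "\<lambda>x. x * _"] lessThan_atLeast0 
        intro!: sum.cong cong: if_cong)
  finally show ?thesis .
qed

lemma precision_mult_geom_corr:
  assumes "0 \<le> \<rho>" "\<rho> < 1"
  shows "precision_mat n \<rho> * geom_corr_matrix n \<rho> = 1\<^sub>m n"
proof -
  define W U where "W = whitening_mat n \<rho>" and "U = response_mat n \<rho>"
  define D where "D d = mat n n (\<lambda>(i, j). if i = j then d i else 0)" for d :: "nat \<Rightarrow> real"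
  define d where "d = innovation_var \<rho>"
  have W: "W \<in> carrier_mat n n" and U: "U \<in> carrier_mat n n" and D: "D f \<in> carrier_mat n n" for f
    by (simp_all add: W_def U_def D_def)
  have DD: "D (\<lambda>i. 1 / d i) * D d = 1\<^sub>m n"
    unfolding D_def d_def using innovation_var_pos[OF assms]
    by (subst diag_mult_mat) (auto intro!: eq_matI simp: less_imp_neq[THEN not_sym])
  have WR: "W * geom_corr_matrix n \<rho> = D d * U"
    unfolding W_def U_def D_def d_def by (rule whitening_geom_corr)
  have "precision_mat n \<rho> * geom_corr_matrix n \<rho>
      = W\<^sup>T * (D (\<lambda>i. 1 / d i) * (W * geom_corr_matrix n \<rho>))"
    unfolding precision_mat_def W_def[symmetric] D_def d_def
    by (subst assoc_mult_mat[of _ n n _ n _ n], use W in auto)+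
  also have "D (\<lambda>i. 1 / d i) * (W * geom_corr_matrix n \<rho>) = U"
    unfolding WR by (subst assoc_mult_mat[OF D D U, symmetric]) (use DD U in simp)
  also have "W\<^sup>T * U = (U\<^sup>T * W)\<^sup>T"
    using W U by (subst transpose_mult[of _ n n _ n]) auto
  also have "U\<^sup>T * W = 1\<^sub>m n"
    using mat_mult_left_right_inverse[OF _ _ whitening_response[of n \<rho>]] by (simp add: U_def W_def)
  finally show ?thesis
    by simp
qed

lemma det_geom_corr: "det (geom_corr_matrix n \<rho>) = (1 - \<rho>\<^sup>2) ^ (n - 1)"
proof -
  define D where "D = mat n n (\<lambda>(i, j). if i = j then innovation_var \<rho> i else 0)"
  have D: "D \<in> carrier_mat n n"
    by (simp add: D_def)
  have "det (whitening_mat n \<rho>) = 1"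
    by (subst det_lower_triangular[of n]) (auto simp: prod_list_diag_prod whitening_mat_def)
  moreover have "det (response_mat n \<rho>) = 1"
    by (subst det_upper_triangular[of _ n])
      (auto simp: prod_list_diag_prod response_mat_def upper_triangular_def)
  moreover have "det D = (\<Prod>i<n. innovation_var \<rho> i)"
    by (subst det_upper_triangular[OF _ D])
      (auto simp: prod_list_diag_prod D_def upper_triangular_def lessThan_atLeast0)
  moreover have "(\<Prod>i<n. innovation_var \<rho> i) = (1 - \<rho>\<^sup>2) ^ (n - 1)"
  proof (induction n)
    case (Suc n)
    then show ?case
      by (cases n) (auto simp: innovation_var_def)
  qed simp
  ultimately show ?thesis
    using arg_cong[OF whitening_geom_corr[of n \<rho>], of det, folded D_def]
      det_mult[OF whitening_carrier geom_corr_carrier, of n \<rho> \<rho>] det_mult[OF D response_carrier]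
    by simp
qed

text \<open>If all innovations of \<open>f\<close> vanish, so does \<open>f\<close>, by induction along the path.\<close>

lemma ar_form_pos:
  assumes \<rho>: "0 \<le> \<rho>" "\<rho> < 1" and nonzero: "i < n" "f i \<noteq> 0"
  shows "ar_form n \<rho> f f > 0"
proof -
  obtain k where k: "k < n" "innovation \<rho> f k \<noteq> 0"
  proof (rule ccontr)
    assume "\<not> thesis"
    then have *: "innovation \<rho> f k = 0" if "k < n" for k
      using that \<open>\<And>k. k < n \<Longrightarrow> innovation \<rho> f k \<noteq> 0 \<Longrightarrow> thesis\<close> by blast
    have "f k = 0" if "k < n" for k
      using that
    proof (induction k)
      case 0
      then show ?case
        using *[of 0] by (simp add: innovation_def)
    next
      case (Suc k)
      then have "innovation \<rho> f (Suc k) = 0"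
        using * by blast
      then show ?case
        using Suc by (simp add: innovation_def)
    qed
    then show False
      using nonzero by simp
  qed
  have "innovation \<rho> f k * innovation \<rho> f k / innovation_var \<rho> k > 0"
    using innovation_var_pos[OF \<rho>] k by (simp flip: power2_eq_square)
  then show ?thesis
    unfolding ar_form_def using innovation_var_pos[OF \<rho>] k
    by (intro sum_pos2[of "{..<n}" k]) (auto simp: less_imp_le)
qed

lemma geom_corr_pos_def:
  assumes \<rho>: "0 \<le> \<rho>" "\<rho> < 1"
  shows "pos_def_with_inverse n (geom_corr_matrix n \<rho>) (precision_mat n \<rho>)"
proof (rule pos_def_with_inverse.intro)
  show "geom_corr_matrix n \<rho> * precision_mat n \<rho> = 1\<^sub>m n"
    by (rule mat_mult_left_right_inverse[OF _ _ precision_mult_geom_corr[OF \<rho>]]) auto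
  show "u \<bullet> (precision_mat n \<rho> *\<^sub>v v) = v \<bullet> (precision_mat n \<rho> *\<^sub>v u)"
    if "u \<in> carrier_vec n" "v \<in> carrier_vec n" for u v
    using that by (simp add: precision_form ar_form_def mult.commute)
  show "v \<bullet> (precision_mat n \<rho> *\<^sub>v v) > 0" if v: "v \<in> carrier_vec n" "v \<noteq> 0\<^sub>v n" for v
  proof -
    obtain i where "i < n" "v $ i \<noteq> 0"
      using v by (metis carrier_vecD eq_vecI index_zero_vec)
    then show ?thesis
      using \<rho> v by (simp add: precision_form ar_form_pos)
  qed
  show "det (geom_corr_matrix n \<rho>) > 0"
    using \<rho> by (simp add: det_geom_corr power_less_one_iff)
qed auto

section \<open>The residual sum of squares near zero correlation\<close>

text \<open>Expanding the innovations of \<open>z - \<delta>\<close> gives a linear term in \<open>\<delta>\<close> that involves only the sum of \<open>z\<close>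
  and its end points. Since \<open>z\<close> is centred, the end points can be traded for the interior points, and
  the \<open>\<delta>\<close>-dependent part becomes a sum of squares. For arbitrary \<open>z\<close> the two sides differ by
  \<open>2 \<delta> (1 - \<rho>) \<Sum>z\<^sub>i\<close>; with this correction the identity is proved by induction on the length.\<close>

lemma ar_form_decomp:
  fixes z :: "nat \<Rightarrow> real"
  assumes \<rho>: "0 \<le> \<rho>" "\<rho> < 1" and n: "n = k + 2" and centred: "(\<Sum>i<n. z i) = 0"
  shows "(1 - \<rho>\<^sup>2) * ar_form n \<rho> (\<lambda>i. z i - \<delta>) (\<lambda>i. z i - \<delta>)
    = (\<Sum>i<n. (z i)\<^sup>2) - 2 * \<rho> * (\<Sum>i<n - 1. z i * z (Suc i))
      + (\<Sum>i<k. (\<rho> * z (Suc i) + (1 - \<rho>) * \<delta>)\<^sup>2) + 2 * (1 - \<rho>) * \<delta>\<^sup>2"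
proof -
  have "1 - \<rho>\<^sup>2 \<noteq> 0"
    using innovation_var_pos[OF \<rho>, of 1] by (simp add: innovation_var_def)
  then have "(1 - \<rho>\<^sup>2) * ar_form n \<rho> f f = (1 - \<rho>\<^sup>2) * (f 0)\<^sup>2 + (\<Sum>i<Suc k. (f (Suc i) - \<rho> * f i)\<^sup>2)" for f
    unfolding ar_form_def n
    by (simp add: sum.lessThan_Suc_shift innovation_def innovation_var_def distrib_left
        sum_distrib_left power2_eq_square del: sum.lessThan_Suc)
  moreover have "(1 - \<rho>\<^sup>2) * (z 0 - \<delta>)\<^sup>2 + (\<Sum>i<Suc k. (z (Suc i) - \<delta> - \<rho> * (z i - \<delta>))\<^sup>2)
      = (\<Sum>i<k + 2. (z i)\<^sup>2) - 2 * \<rho> * (\<Sum>i<Suc k. z i * z (Suc i))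
      + (\<Sum>i<k. (\<rho> * z (Suc i) + (1 - \<rho>) * \<delta>)\<^sup>2) + 2 * (1 - \<rho>) * \<delta>\<^sup>2
      - 2 * \<delta> * (1 - \<rho>) * (\<Sum>i<k + 2. z i)" for k
  proof (induction k)
    case 0
    show ?case
      by (simp add: numeral_2_eq_2) (simp add: power2_eq_square algebra_simps)
  next
    case (Suc k)
    then show ?case
      by (simp add: power2_eq_square algebra_simps)
  qed
  ultimately show ?thesis
    using centred by (simp add: n)
qed

lemma ar_form_cong:
  assumes "\<And>i. i < n \<Longrightarrow> f i = f' i" "\<And>i. i < n \<Longrightarrow> g i = g' i"
  shows "ar_form n \<rho> f g = ar_form n \<rho> f' g'"
  unfolding ar_form_def innovation_def using assms by (auto intro!: sum.cong)

lemma geom_residual_form: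
  assumes \<rho>: "0 \<le> \<rho>" "\<rho> < 1" and y: "y \<in> carrier_vec n" and n: "n = k + 2"
  defines "z \<equiv> \<lambda>i. y $ i - mean_vec y"
  shows "(1 - \<rho>\<^sup>2) * ((y - \<theta> \<cdot>\<^sub>v ones_vec n) \<bullet> (precision_mat n \<rho> *\<^sub>v (y - \<theta> \<cdot>\<^sub>v ones_vec n)))
    = (\<Sum>i<n. (z i)\<^sup>2) - 2 * \<rho> * (\<Sum>i<n - 1. z i * z (Suc i))
      + (\<Sum>i<k. (\<rho> * z (Suc i) + (1 - \<rho>) * (\<theta> - mean_vec y))\<^sup>2) + 2 * (1 - \<rho>) * (\<theta> - mean_vec y)\<^sup>2"
proof -
  have centred: "(\<Sum>i<n. z i) = 0"
    using y n by (simp add: z_def sum_subtractf mean_vec_def)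
  have "(y - \<theta> \<cdot>\<^sub>v ones_vec n) \<bullet> (precision_mat n \<rho> *\<^sub>v (y - \<theta> \<cdot>\<^sub>v ones_vec n))
      = ar_form n \<rho> (\<lambda>i. (y - \<theta> \<cdot>\<^sub>v ones_vec n) $ i) (\<lambda>i. (y - \<theta> \<cdot>\<^sub>v ones_vec n) $ i)"
    by (rule precision_form) (use y in auto)
  also have "\<dots> = ar_form n \<rho> (\<lambda>i. z i - (\<theta> - mean_vec y)) (\<lambda>i. z i - (\<theta> - mean_vec y))"
    by (rule ar_form_cong) (use y in \<open>auto simp: z_def ones_vec_def\<close>)
  finally show ?thesis
    using ar_form_decomp[OF \<rho> n centred] by simp
qed

lemma geom_S2_ge:
  assumes \<rho>: "0 \<le> \<rho>" "\<rho> < 1" and y: "y \<in> carrier_vec n" and n: "n = k + 2"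
  defines "z \<equiv> \<lambda>i. y $ i - mean_vec y"
  shows "(\<Sum>i<n. (z i)\<^sup>2) - 2 * \<rho> * (\<Sum>i<n - 1. z i * z (Suc i))
    \<le> (1 - \<rho>\<^sup>2) * S2 (geom_corr_matrix n \<rho>) y"
proof -
  interpret pos_def_with_inverse n "geom_corr_matrix n \<rho>" "precision_mat n \<rho>"
    by (rule geom_corr_pos_def[OF \<rho>])
  obtain \<theta> where \<theta>: "(y - \<theta> \<cdot>\<^sub>v ones_vec n) \<bullet> (precision_mat n \<rho> *\<^sub>v (y - \<theta> \<cdot>\<^sub>v ones_vec n))
      = S2 (geom_corr_matrix n \<rho>) y"
    using S2_attained[OF y] n by auto
  have "0 \<le> (\<Sum>i<k. (\<rho> * z (Suc i) + (1 - \<rho>) * (\<theta> - mean_vec y))\<^sup>2)"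
    by (simp add: sum_nonneg)
  moreover have "0 \<le> 2 * (1 - \<rho>) * (\<theta> - mean_vec y)\<^sup>2"
    using \<rho> by simp
  ultimately show ?thesis
    using geom_residual_form[OF \<rho> y n, of \<theta>] unfolding \<theta> z_def by linarith
qed

text \<open>The sample mean is a competitor for the minimizing \<open>\<theta>\<close>; it makes \<open>\<delta> = 0\<close>.\<close>

lemma geom_S2_le:
  assumes \<rho>: "0 \<le> \<rho>" "\<rho> < 1" and y: "y \<in> carrier_vec n" and n: "n = k + 2"
  defines "z \<equiv> \<lambda>i. y $ i - mean_vec y"
  shows "(1 - \<rho>\<^sup>2) * S2 (geom_corr_matrix n \<rho>) y
    \<le> (\<Sum>i<n. (z i)\<^sup>2) - 2 * \<rho> * (\<Sum>i<n - 1. z i * z (Suc i)) + \<rho>\<^sup>2 * (\<Sum>i<k. (z (Suc i))\<^sup>2)"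
proof -
  interpret pos_def_with_inverse n "geom_corr_matrix n \<rho>" "precision_mat n \<rho>"
    by (rule geom_corr_pos_def[OF \<rho>])
  let ?v = "y - mean_vec y \<cdot>\<^sub>v ones_vec n"
  have "(1 - \<rho>\<^sup>2) * S2 (geom_corr_matrix n \<rho>) y \<le> (1 - \<rho>\<^sup>2) * (?v \<bullet> (precision_mat n \<rho> *\<^sub>v ?v))"
    using S2_le_residual_form[OF y, of "mean_vec y"] n \<rho>
    by (intro mult_left_mono) (auto simp: power_le_one)
  then show ?thesis
    unfolding geom_residual_form[OF \<rho> y n] z_def
    by (simp add: power_mult_distrib sum_distrib_left)
qed

lemma geom_S2_at_0:
  assumes y: "y \<in> carrier_vec n" and n: "n = k + 2"
  shows "S2 (geom_corr_matrix n 0) y = (\<Sum>i<n. (y $ i - mean_vec y)\<^sup>2)"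
  using geom_S2_ge[OF _ _ y n, of 0] geom_S2_le[OF _ _ y n, of 0] by simp

lemma isCont_ar_form: "isCont (\<lambda>\<rho>. ar_form n \<rho> f g) 0"
proof -
  have "isCont (\<lambda>\<rho>. innovation \<rho> h i) 0" for h i
    by (cases i) (auto simp: innovation_def intro!: continuous_intros)
  moreover have "isCont (\<lambda>\<rho>. innovation_var \<rho> i) 0" for i
    by (cases i) (auto simp: innovation_var_def intro!: continuous_intros)
  moreover have "innovation_var 0 i \<noteq> 0" for i
    by (simp add: innovation_var_def)
  ultimately show ?thesis
    unfolding ar_form_def by (intro continuous_intros) auto
qed

text \<open>The closed form of \<open>S\<^sup>2\<close> in terms of the autoregressive form is a rational function of \<open>\<rho>\<close> whose
  denominators do not vanish at \<open>\<rho> = 0\<close>.\<close>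

lemma geom_S2_tendsto_0:
  assumes y: "y \<in> carrier_vec n" and n: "n > 0"
  shows "((\<lambda>\<rho>. S2 (geom_corr_matrix n \<rho>) y) \<longlongrightarrow> S2 (geom_corr_matrix n 0) y) (at_right 0)"
proof -
  let ?u = "\<lambda>i. ones_vec n $ i" and ?y = "\<lambda>i. y $ i"
  define H where "H \<rho> = ar_form n \<rho> ?y ?y - (ar_form n \<rho> ?u ?y)\<^sup>2 / ar_form n \<rho> ?u ?u" for \<rho>
  have S2_H: "S2 (geom_corr_matrix n \<rho>) y = H \<rho>" if \<rho>: "0 \<le> \<rho>" "\<rho> < 1" for \<rho>
    using pos_def_with_inverse.S2_eq[OF geom_corr_pos_def[OF \<rho>] y] y
    by (simp add: H_def precision_form)
  have "ar_form n 0 ?u ?u > 0"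
    using n by (intro ar_form_pos[of _ 0]) (auto simp: ones_vec_def)
  then have "isCont H 0"
    unfolding H_def by (intro continuous_intros isCont_ar_form) simp
  then have "(H \<longlongrightarrow> H 0) (at_right 0)"
    by (simp add: isCont_def filterlim_at_split)
  moreover have "\<forall>\<^sub>F \<rho> in at_right (0 :: real). S2 (geom_corr_matrix n \<rho>) y = H \<rho>"
    by (rule eventually_at_rightI[of 0 1]) (auto simp: S2_H)
  ultimately show ?thesis
    using S2_H[of 0] by (simp add: filterlim_cong)
qed

section \<open>Comparing the profile likelihood with its value at zero\<close>

text \<open>Both parts compare \<open>F\<close>, a decreasing transform of \<open>L\<close>, through \<open>N = (1 - \<rho>\<^sup>2) S\<^sup>2\<close> and
  \<open>(1 - \<rho>\<^sup>2) F = N\<^sup>n\<close>, which avoids derivatives.\<close>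

lemma profile_compared_to_zero:
  fixes L :: "real \<Rightarrow> real"
  assumes y: "y \<in> carrier_vec n" and nonconst: "p < n" "q < n" "y $ p \<noteq> y $ q" and c: "c > 0"
    and L: "\<And>\<rho>. 0 \<le> \<rho> \<Longrightarrow> \<rho> < 1 \<Longrightarrow> L \<rho> =
      c * det (geom_corr_matrix n \<rho>) powr (- 1 / 2) * S2 (geom_corr_matrix n \<rho>) y powr (- real n / 2)"
  defines "s \<equiv> \<Sum>i<n - 1. (y $ i - mean_vec y) * (y $ Suc i - mean_vec y)"
  shows "s \<le> 0 \<Longrightarrow> 0 < \<rho> \<Longrightarrow> \<rho> < 1 \<Longrightarrow> L \<rho> < L 0"
    and "s > 0 \<Longrightarrow> \<exists>\<rho>. 0 < \<rho> \<and> \<rho> < 1 \<and> L 0 < L \<rho>"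
proof -
  have "n \<ge> 2"
    using nonconst by (cases "p = q") auto
  then obtain k where n: "n = k + 2"
    by (metis le_add_diff_inverse2)
  define S where "S \<rho> = S2 (geom_corr_matrix n \<rho>) y" for \<rho>
  define N where "N \<rho> = (1 - \<rho>\<^sup>2) * S \<rho>" for \<rho>
  define F where "F \<rho> = (1 - \<rho>\<^sup>2) ^ (n - 1) * S \<rho> ^ n" for \<rho>
  define a where "a = (\<Sum>i<n. (y $ i - mean_vec y)\<^sup>2)"
  have S_pos: "S \<rho> > 0" and d_pos: "1 - \<rho>\<^sup>2 > 0" if "0 \<le> \<rho>" "\<rho> < 1" for \<rho>
    using pos_def_with_inverse.S2_pos[OF geom_corr_pos_def[OF that] y nonconst] that
    by (auto simp: S_def power_less_one_iff)
  have S0: "S 0 = a"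
    unfolding S_def a_def by (rule geom_S2_at_0[OF y n])
  have a: "a > 0"
    using S_pos[of 0] S0 by simp
  have F_pos: "F \<rho> > 0" if "0 \<le> \<rho>" "\<rho> < 1" for \<rho>
    using S_pos[OF that] d_pos[OF that] by (simp add: F_def)
  have LF: "L \<rho> = c * F \<rho> powr (- 1 / 2)" if \<rho>: "0 \<le> \<rho>" "\<rho> < 1" for \<rho>
  proof -
    have "(S \<rho> ^ n) powr (- 1 / 2) = S \<rho> powr (- real n / 2)"
      using S_pos[OF \<rho>] by (simp add: powr_powr flip: powr_realpow)
    then show ?thesis
      using S_pos[OF \<rho>] d_pos[OF \<rho>] by (simp add: L[OF \<rho>] F_def det_geom_corr powr_mult S_def)
  qed
  have L_less: "L \<rho> < L \<rho>'" if "F \<rho>' < F \<rho>" "0 \<le> \<rho>" "\<rho> < 1" "0 \<le> \<rho>'" "\<rho>' < 1" for \<rho> \<rho>'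
    unfolding LF[OF that(2,3)] LF[OF that(4,5)]
    using c F_pos[OF that(4,5)] that(1) by (intro mult_strict_left_mono powr_less_mono2_neg) auto
  have NF: "(1 - \<rho>\<^sup>2) * F \<rho> = N \<rho> ^ n" for \<rho>
    unfolding F_def N_def n by (simp add: power_mult_distrib)
  have F0: "F 0 = a ^ n"
    by (simp add: F_def S0)
  show "L \<rho> < L 0" if s: "s \<le> 0" and \<rho>: "0 < \<rho>" "\<rho> < 1"
  proof (rule L_less)
    have "a \<le> N \<rho>"
      using geom_S2_ge[of \<rho>, OF _ _ y n] \<rho> mult_nonneg_nonpos[of "2 * \<rho>" s] s
      by (simp add: N_def S_def a_def s_def)
    then have "a ^ n \<le> (1 - \<rho>\<^sup>2) * F \<rho>"
      unfolding NF using a by (simp add: power_mono)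
    also have "\<dots> < 1 * F \<rho>"
      using F_pos[of \<rho>] \<rho> by (intro mult_strict_right_mono) auto
    finally show "F 0 < F \<rho>"
      by (simp add: F0)
  qed (use \<rho> in auto)
  show "\<exists>\<rho>. 0 < \<rho> \<and> \<rho> < 1 \<and> L 0 < L \<rho>" if s: "s > 0"
  proof -
    define b where "b = (\<Sum>i<k. (y $ Suc i - mean_vec y)\<^sup>2)"
    have b: "b \<ge> 0"
      by (simp add: b_def sum_nonneg)
    \<comment> \<open>Small enough that the quadratic term takes at most half of the first-order gain \<open>2 \<rho> s\<close>, and
      that the other half exceeds the loss \<open>\<rho>\<^sup>2 a\<close> from the factor \<open>1 - \<rho>\<^sup>2\<close>.\<close>
    define \<rho> where "\<rho> = min (1 / 2) (min (s / (2 * a)) (s / (b + 1)))"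
    have \<rho>: "0 < \<rho>" "\<rho> < 1"
      using s a b by (auto simp: \<rho>_def)
    have "\<rho> \<le> s / (b + 1)" "\<rho> \<le> s / (2 * a)"
      by (auto simp: \<rho>_def)
    then have "\<rho> * (b + 1) \<le> s" "\<rho> * (2 * a) \<le> s"
      using a b by (simp_all add: pos_le_divide_eq)
    moreover have "\<rho> * a > 0"
      using \<rho> a by simp
    ultimately have \<rho>b: "\<rho> * b \<le> s" and \<rho>a: "\<rho> * a < s"
      using \<rho> by (auto simp: algebra_simps)
    have N_pos: "N \<rho> > 0"
      using S_pos[of \<rho>] d_pos[of \<rho>] \<rho> by (simp add: N_def)
    have "N \<rho> \<le> a - 2 * \<rho> * s + \<rho>\<^sup>2 * b"
      using geom_S2_le[of \<rho>, OF _ _ y n] \<rho> by (simp add: N_def S_def a_def s_def b_def)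
    also have "\<dots> \<le> a - \<rho> * s"
      using mult_left_mono[OF \<rho>b, of \<rho>] \<rho> by (simp add: power2_eq_square)
    also have "\<dots> < a - \<rho> * (\<rho> * a)"
      using mult_strict_left_mono[OF \<rho>a] \<rho> by simp
    also have "\<dots> = (1 - \<rho>\<^sup>2) * a"
      by (simp add: power2_eq_square algebra_simps)
    finally have less: "N \<rho> < (1 - \<rho>\<^sup>2) * a" .
    also have "\<dots> \<le> 1 * a"
      using a by (intro mult_right_mono) auto
    finally have le: "N \<rho> \<le> a"
      by simp
    have "(1 - \<rho>\<^sup>2) * F \<rho> = N \<rho> * N \<rho> ^ (n - 1)"
      unfolding NF n by simp
    also have "\<dots> < (1 - \<rho>\<^sup>2) * a * a ^ (n - 1)"
      using less le N_pos a by (intro mult_less_le_imp_less power_mono) auto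
    also have "\<dots> = (1 - \<rho>\<^sup>2) * F 0"
      unfolding F0 n by simp
    finally have "F \<rho> < F 0"
      using d_pos[of \<rho>] \<rho> by simp
    then show ?thesis
      using L_less[OF \<open>F \<rho> < F 0\<close>] \<rho> by auto
  qed
qed

section \<open>The power exponential correlation on an equispaced design\<close>

lemma equispaced_design:
  assumes "x \<in> carrier_vec n" "\<And>i. Suc i < n \<Longrightarrow> x $ Suc i = x $ i + d" "i < n"
  shows "x $ i = x $ 0 + real i * d"
  using \<open>i < n\<close> by (induction i) (auto simp: assms(2) algebra_simps)

lemma corr_matrix_equispaced:
  assumes d: "d > 0" and \<gamma>: "\<gamma> > 0"
    and x: "x \<in> carrier_vec n" "\<And>i. Suc i < n \<Longrightarrow> x $ Suc i = x $ i + d"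
  shows "corr_matrix \<gamma> 1 x = geom_corr_matrix n (exp (- d / \<gamma>))"
proof (rule eq_matI)
  fix i j
  assume "i < dim_row (geom_corr_matrix n (exp (- d / \<gamma>)))" "j < dim_col (geom_corr_matrix n (exp (- d / \<gamma>)))"
  then have ij: "i < n" "j < n"
    by (auto simp: geom_corr_matrix_def)
  have "x $ i - x $ j = (real i - real j) * d"
    using equispaced_design[OF x ij(1)] equispaced_design[OF x ij(2)] by (simp add: algebra_simps)
  then have "\<bar>x $ i - x $ j\<bar> = real (nat \<bar>int i - int j\<bar>) * d"
    using d by (simp add: abs_mult)
  then show "corr_matrix \<gamma> 1 x $$ (i, j) = geom_corr_matrix n (exp (- d / \<gamma>)) $$ (i, j)"
    using ij x d \<gamma>
    by (simp add: corr_matrix_def geom_corr_matrix_def power_exp_corr_def flip: exp_of_nat_mult)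
qed (use x in \<open>auto simp: corr_matrix_def geom_corr_matrix_def\<close>)

section \<open>The condition for a mode at zero\<close>

theorem lemma3p1:
  fixes n :: nat and d0 :: real and x y :: "real vec" and L :: "real \<Rightarrow> real"
  assumes spacing: "d0 > 0"
    and design: "x \<in> carrier_vec n" "\<And>i. Suc i < n \<Longrightarrow> x $ Suc i = x $ i + d0"
    and outputs: "y \<in> carrier_vec n" "\<exists>i<n. \<exists>j<n. y $ i \<noteq> y $ j"
    and profile: "\<And>\<gamma>. \<gamma> > 0 \<Longrightarrow> L (exp (- d0 / \<gamma>)) = profile_likelihood (corr_matrix \<gamma> 1 x) y"
    and value_at_0: "(L \<longlongrightarrow> L 0) (at_right 0)"
  shows "(\<forall>\<gamma>>0. corr_matrix \<gamma> 1 x = geom_corr_matrix n (exp (- d0 / \<gamma>)))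
       \<and> (\<exists>c>0. \<forall>\<rho>\<in>{0..<1}. L \<rho> =
            c * det (geom_corr_matrix n \<rho>) powr (- 1 / 2)
              * S2 (geom_corr_matrix n \<rho>) y powr (- real n / 2))
       \<and> (0 \<in> modes L \<longleftrightarrow>
            (\<Sum>i<n - 1. (y $ i - mean_vec y) * (y $ Suc i - mean_vec y)) \<le> 0)
       \<and> (modes L = {0} \<longleftrightarrow>
            (\<Sum>i<n - 1. (y $ i - mean_vec y) * (y $ Suc i - mean_vec y)) \<le> 0)"
proof -
  let ?s = "\<Sum>i<n - 1. (y $ i - mean_vec y) * (y $ Suc i - mean_vec y)"
  obtain p q where pq: "p < n" "q < n" "y $ p \<noteq> y $ q"
    using outputs(2) by blast
  have corr: "corr_matrix \<gamma> 1 x = geom_corr_matrix n (exp (- d0 / \<gamma>))" if "\<gamma> > 0" for \<gamma>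
    by (rule corr_matrix_equispaced[OF spacing that design])
  define c where "c = (2 * pi) powr (- real n / 2) * (real n powr (real n / 2) * exp (- real n / 2))"
  have c: "c > 0"
    using pq by (simp add: c_def)
  define G where "G \<rho> = c * det (geom_corr_matrix n \<rho>) powr (- 1 / 2)
    * S2 (geom_corr_matrix n \<rho>) y powr (- real n / 2)" for \<rho>
  have L_pos: "L \<rho> = G \<rho>" if \<rho>: "0 < \<rho>" "\<rho> < 1" for \<rho>
  proof -
    define \<gamma> where "\<gamma> = - d0 / ln \<rho>"
    have \<gamma>: "\<gamma> > 0"
      using spacing \<rho> by (simp add: \<gamma>_def divide_pos_neg)
    have exp_\<gamma>: "exp (- d0 / \<gamma>) = \<rho>"
      using spacing \<rho> by (simp add: \<gamma>_def)
    have "L \<rho> = profile_likelihood (geom_corr_matrix n \<rho>) y"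
      using profile[OF \<gamma>] unfolding corr[OF \<gamma>] exp_\<gamma> .
    also have "\<dots> = G \<rho>"
      using pos_def_with_inverse.profile_likelihood_eq[OF geom_corr_pos_def outputs(1) pq] \<rho>
      by (simp add: G_def c_def)
    finally show ?thesis .
  qed
  have "(G \<longlongrightarrow> G 0) (at_right 0)"
    unfolding G_def det_geom_corr
    using geom_S2_tendsto_0[OF outputs(1)] pq
      pos_def_with_inverse.S2_pos[OF geom_corr_pos_def outputs(1) pq, of 0]
    by (intro tendsto_intros) auto
  moreover have "\<forall>\<^sub>F \<rho> in at_right 0. G \<rho> = L \<rho>"
    by (rule eventually_at_rightI[of 0 1]) (auto simp: L_pos)
  ultimately have "(L \<longlongrightarrow> G 0) (at_right 0)"
    by (rule Lim_transform_eventually)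
  then have "L 0 = G 0"
    using value_at_0 by (intro tendsto_unique[OF _ value_at_0]) auto
  then have L: "L \<rho> = G \<rho>" if "0 \<le> \<rho>" "\<rho> < 1" for \<rho>
    using L_pos[of \<rho>] that by (cases "\<rho> = 0") auto
  note mode = profile_compared_to_zero[OF outputs(1) pq c L[unfolded G_def]]
  have "modes L = {0}" if "?s \<le> 0"
  proof -
    have less: "L \<rho> < L 0" if "0 \<le> \<rho>" "\<rho> < 1" "\<rho> \<noteq> 0" for \<rho>
      using mode(1)[of \<rho>] \<open>?s \<le> 0\<close> that by simp
    have le: "L \<rho> \<le> L 0" if "0 \<le> \<rho>" "\<rho> < 1" for \<rho>
      using less[OF that] by (cases "\<rho> = 0") auto
    have "0 \<in> modes L"
      by (auto simp: modes_def is_arg_max_def) (metis le leD)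
    moreover have "\<rho> = 0" if "\<rho> \<in> modes L" for \<rho>
    proof (rule ccontr)
      assume "\<rho> \<noteq> 0"
      then have "L \<rho> < L 0"
        using less[of \<rho>] that by (simp add: modes_def is_arg_max_def)
      then show False
        using that by (auto simp: modes_def is_arg_max_def)
    qed
    ultimately show ?thesis
      by blast
  qed
  moreover have "?s \<le> 0" if "0 \<in> modes L"
  proof (rule ccontr)
    assume "\<not> ?s \<le> 0"
    then obtain \<rho> where "0 < \<rho>" "\<rho> < 1" "L 0 < L \<rho>"
      using mode(2) by auto
    then show False
      using that by (auto simp: modes_def is_arg_max_def dest!: spec[of _ \<rho>])
  qed
  ultimately have "(0 \<in> modes L \<longleftrightarrow> ?s \<le> 0) \<and> (modes L = {0} \<longleftrightarrow> ?s \<le> 0)"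
    by auto
  moreover have "\<exists>c>0. \<forall>\<rho>\<in>{0..<1}. L \<rho> = c * det (geom_corr_matrix n \<rho>) powr (- 1 / 2)
      * S2 (geom_corr_matrix n \<rho>) y powr (- real n / 2)"
    using c L unfolding G_def by (intro exI[of _ c]) auto
  ultimately show ?thesis
    using corr by blast
qed

end
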